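(* Let $\mathbb{X}=[0,1]$. For each $n\in\mathbb{N}$, there exists a sequence of soft-max gating vectors $$\left\{\mathbf{Gate}_l=\left(\mathrm{Gate}_k(\cdot;\boldsymbol{\gamma}_l)\right)_{k\in[n]}\right\}_{l\in\mathbb{N}}\subset\mathcal{G}_S^n,$$ defined by a sequence of parameters $\{\boldsymbol{\gamma}_l\}_{l\in\mathbb{N}}\subset\mathbb{G}_S^n$, such that, as $l\to\infty$, $$\mathrm{Gate}_k(\cdot;\boldsymbol{\gamma}_l)\to\mathbf{1}_{\{x\in\mathbb{X}_k^n\}}$$ almost uniformly on $\mathbb{X}$, simultaneously for all $k\in[n]$; that is, for every $\delta>0$ there exists a measurable set $\mathbb{E}_\delta\subset\mathbb{X}$ with $\lambda(\mathbb{E}_\delta)<\delta$ such that, for every $k\in[n]$, $\mathrm{Gate}_k(\cdot;\boldsymbol{\gamma}_l)$ converges to $\mathbf{1}_{\{x\in\mathbb{X}_k^n\}}$ uniformly on $\mathbb{X}\setminus\mathbb{E}_\delta$ as $l\to\infty$.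
   Context: $\lambda$ denotes Lebesgue measure on $\mathbb{R}$, $[n]=\{1,\dots,n\}$, and $\mathbf{1}_{\{x\in A\}}$ is the indicator function of the set $A$. The sets $\mathbb{X}_k^n$, $k\in[n]$, partition $[0,1]$: $\mathbb{X}_k^n=\left[(k-1)/n,\,k/n\right)$ for $k\in[n-1]$, and $\mathbb{X}_n^n=\left[(n-1)/n,\,1\right]$. The parameter space is $\mathbb{G}_S^n=\{\boldsymbol{\gamma}=(a_1,\dots,a_n,b_1,\dots,b_n)\in\mathbb{R}^n\times\mathbb{R}^n\}$, and the soft-max gating class $\mathcal{G}_S^n$ (with input dimension $d=1$) is the set of all vectors $(\mathrm{Gate}_k(\cdot;\boldsymbol{\gamma}))_{k\in[n]}$ of functions on $\mathbb{X}$ given by $$\mathrm{Gate}_k(x;\boldsymbol{\gamma})=\frac{\exp(a_k+b_kx)}{\sum_{i=1}^n\exp(a_i+b_ix)},\qquad k\in[n],\ \boldsymbol{\gamma}\in\mathbb{G}_S^n.$$ *)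

theory Defs
  imports "HOL-Analysis.Analysis"
begin

definition cell :: "nat \<Rightarrow> nat \<Rightarrow> real set" where
  "cell n k = (if k < n then {(real k - 1) / real n ..< real k / real n}
               else {(real n - 1) / real n .. 1})"

(* R^n is the set of extensional functions on {1..n}; a parameter is a pair (a, b). *)
definition softmax_params :: "nat \<Rightarrow> ((nat \<Rightarrow> real) \<times> (nat \<Rightarrow> real)) set" where
  "softmax_params n = ({1..n} \<rightarrow>\<^sub>E UNIV) \<times> ({1..n} \<rightarrow>\<^sub>E UNIV)"

definition softmax_gate :: "nat \<Rightarrow> (nat \<Rightarrow> real) \<times> (nat \<Rightarrow> real) \<Rightarrow> nat \<Rightarrow> real \<Rightarrow> real" where
  "softmax_gate n \<gamma> k x =
     exp (fst \<gamma> k + snd \<gamma> k * x) / (\<Sum>i=1..n. exp (fst \<gamma> i + snd \<gamma> i * x))"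

(* A vector indexed by {1..n} of functions whose domain is [0,1]. *)
definition softmax_gate_vector :: "nat \<Rightarrow> (nat \<Rightarrow> real) \<times> (nat \<Rightarrow> real) \<Rightarrow> nat \<Rightarrow> real \<Rightarrow> real" where
  "softmax_gate_vector n \<gamma> = (\<lambda>k\<in>{1..n}. \<lambda>x\<in>{0..1}. softmax_gate n \<gamma> k x)"

definition softmax_gating_class :: "nat \<Rightarrow> (nat \<Rightarrow> real \<Rightarrow> real) set" where
  "softmax_gating_class n = softmax_gate_vector n ` softmax_params n"

end

theory Submission
  imports Defs "HOL-Real_Asymp.Real_Asymp"
begin

text \<open>
  The functions \<open>h\<^sub>k(x) = k x - k (k - 1) / (2 n)\<close> are affine in \<open>x\<close>, and the graph of \<open>h\<^sub>k\<close> is the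
  highest one exactly over the \<open>k\<close>-th cell, because \<open>h\<^sub>k - h\<^sub>j = (k - j) (x - (j + k - 1) / (2 n))\<close>.
  At distance at least \<open>\<eta>\<close> from the grid points \<open>i / n\<close> it exceeds all the others by at least \<open>\<eta>\<close>.
  Hence the soft-max gates with exponents \<open>l h\<^sub>k(x)\<close> differ from the indicators by at most
  \<open>n exp (- l \<eta>)\<close> there, and the exceptional neighbourhood of the grid has measure at most
  \<open>2 \<eta> (n + 1)\<close>.
\<close>

text \<open>The denominator is at least its \<open>k\<close>-th summand, so the \<open>j\<close>-th
  gate is at most the quotient of the \<open>j\<close>-th and \<open>k\<close>-th
  exponentials.\<close>

lemma softmax_gate_le_exp:
  assumes "k \<in> {1..n}" "fst \<gamma> j + snd \<gamma> j * x \<le> fst \<gamma> k + snd \<gamma> k * x - c"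
  shows "softmax_gate n \<gamma> j x \<le> exp (- c)"
proof -
  let ?e = "\<lambda>i. exp (fst \<gamma> i + snd \<gamma> i * x)"
  have "?e j \<le> exp (- c) * ?e k"
    using assms(2) by (simp add: exp_add [symmetric])
  also have "\<dots> \<le> exp (- c) * (\<Sum>i=1..n. ?e i)"
    using member_le_sum[of k "{1..n}" ?e] assms(1) by simp
  finally have "?e j \<le> exp (- c) * (\<Sum>i=1..n. ?e i)" .
  moreover have "(\<Sum>i=1..n. ?e i) > 0"
    using assms(1) by (intro sum_pos) auto
  ultimately show ?thesis
    by (simp add: softmax_gate_def divide_le_eq)
qed

lemma softmax_gate_nonneg: "softmax_gate n \<gamma> k x \<ge> 0"
  by (simp add: softmax_gate_def sum_nonneg)

lemma sum_softmax_gate: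
  assumes "n \<ge> 1"
  shows "(\<Sum>k=1..n. softmax_gate n \<gamma> k x) = 1"
proof -
  have "(\<Sum>i=1..n. exp (fst \<gamma> i + snd \<gamma> i * x)) > 0"
    using assms by (intro sum_pos) auto
  then show ?thesis
    by (simp add: softmax_gate_def flip: sum_divide_distrib)
qed

text \<open>For \<open>j \<noteq> k\<close> a single gate is at most \<open>exp (- c)\<close>. For
  \<open>j = k\<close> the gates sum to 1, so the deficit is the sum of the other
  \<open>n - 1\<close> gates, each bounded in that way.\<close>

lemma softmax_gate_near_of_bool:
  assumes k: "k \<in> {1..n}" and j: "j \<in> {1..n}"
    and gap: "\<And>i. i \<in> {1..n} \<Longrightarrow> i \<noteq> k \<Longrightarrow> fst \<gamma> i + snd \<gamma> i * x \<le> fst \<gamma> k + snd \<gamma> k * x - c"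
  shows "\<bar>softmax_gate n \<gamma> j x - of_bool (j = k)\<bar> \<le> real n * exp (- c)"
proof (cases "j = k")
  case False
  then have "softmax_gate n \<gamma> j x \<le> 1 * exp (- c)"
    using softmax_gate_le_exp[OF k gap[OF j]] by simp
  also have "\<dots> \<le> real n * exp (- c)"
    using k by (intro mult_right_mono) auto
  finally show ?thesis
    using False softmax_gate_nonneg[of n \<gamma> j x] by simp
next
  case True
  have "softmax_gate n \<gamma> k x + (\<Sum>i\<in>{1..n} - {k}. softmax_gate n \<gamma> i x) = 1"
    using sum_softmax_gate[of n \<gamma> x] k sum.remove[of "{1..n}" k "\<lambda>i. softmax_gate n \<gamma> i x"] by simp
  moreover have "(\<Sum>i\<in>{1..n} - {k}. softmax_gate n \<gamma> i x) \<ge> 0"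
    by (intro sum_nonneg softmax_gate_nonneg)
  moreover have "(\<Sum>i\<in>{1..n} - {k}. softmax_gate n \<gamma> i x) \<le> (\<Sum>i\<in>{1..n} - {k}. exp (- c))"
    by (intro sum_mono softmax_gate_le_exp[OF k] gap) auto
  moreover have "\<dots> \<le> real n * exp (- c)"
    by (auto intro!: mult_right_mono simp: card_Diff_singleton_if)
  ultimately have "\<bar>softmax_gate n \<gamma> k x - 1\<bar> \<le> real n * exp (- c)"
    by linarith
  then show ?thesis
    using True by simp
qed

lemma cell_bounds:
  assumes "n \<ge> 1" "k \<in> {1..n}" "x \<in> cell n k"
  shows "(real k - 1) / real n \<le> x" "x \<le> real k / real n"
  using assms by (auto simp: cell_def split: if_splits)

lemma ex_cell:
  assumes "n \<ge> 1" "x \<in> {0..1}"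
  shows "\<exists>k\<in>{1..n}. x \<in> cell n k"
\<comment> \<open>The last cell is closed and is split off: at \<open>x = 1\<close> the floor below
  would give the index \<open>n + 1\<close>.\<close>
proof (cases "x < (real n - 1) / real n")
  case False
  then show ?thesis
    using assms by (intro bexI[of _ n]) (auto simp: cell_def)
next
  case True
  \<comment> \<open>Cells are numbered from 1, so the floor is one less than the index of the
    cell.\<close>
  define m where "m = nat \<lfloor>x * real n\<rfloor>"
  have m: "real m \<le> x * real n" "x * real n < real m + 1"
    using assms by (auto simp: m_def)
  have "x * real n < real n - 1"
    using True assms by (simp add: less_divide_eq)
  with m have "Suc m < n"
    by linarith
  moreover have "x \<in> cell n (Suc m)"
    using m assms \<open>Suc m < n\<close> by (auto simp: cell_def divide_le_eq less_divide_eq add.commute)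
  ultimately show ?thesis
    by (intro bexI[of _ "Suc m"]) auto
qed

lemma cell_unique:
  assumes "j \<in> {1..n}" "k \<in> {1..n}" "x \<in> cell n j" "x \<in> cell n k"
  shows "j = k"
proof -
  \<comment> \<open>The smaller index is below \<open>n\<close>, so its cell is half-open and its
    upper bound is strict.\<close>
  have False if "i < m" "m \<le> n" "x \<in> cell n i" "x \<in> cell n m" for i m
  proof -
    have "x < real i / real n" "(real m - 1) / real n \<le> x"
      using that by (auto simp: cell_def split: if_splits)
    then have "(real m - 1) / real n < real i / real n"
      by linarith
    moreover have "(real m - 1) / real n \<ge> real i / real n"
      using that by (intro divide_right_mono) auto
    ultimately show False
      by simp
  qed
  from this[of j k] this[of k j] assms show ?thesis
    by (cases j k rule: linorder_cases) auto
qed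

text \<open>The exponents are \<open>l\<close> times the affine functions described at the start,
  whose graphs for \<open>k\<close> and \<open>k + 1\<close> cross at the grid point
  \<open>k / n\<close>. Growing \<open>l\<close> sharpens the soft-max towards the maximum.\<close>

definition cell_params :: "nat \<Rightarrow> nat \<Rightarrow> (nat \<Rightarrow> real) \<times> (nat \<Rightarrow> real)" where
  "cell_params n l = ((\<lambda>k\<in>{1..n}. - (real l * (real k * (real k - 1) / (2 * real n)))),
                      (\<lambda>k\<in>{1..n}. real l * real k))"

lemma cell_params_gap:
  assumes k: "k \<in> {1..n}" and j: "j \<in> {1..n}" "j \<noteq> k" and x: "x \<in> cell n k"
    and \<eta>: "\<eta> \<ge> 0" "\<And>i. i \<le> n \<Longrightarrow> \<bar>x - real i / real n\<bar> \<ge> \<eta>"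
  shows "fst (cell_params n l) j + snd (cell_params n l) j * x
       \<le> fst (cell_params n l) k + snd (cell_params n l) k * x - real l * \<eta>"
proof -
  have n: "n \<ge> 1"
    using k by simp
  \<comment> \<open>Both endpoints of the cell are grid points, so the distance hypothesis pushes
    \<open>x\<close> inwards by \<eta>.\<close>
  have lower: "(real k - 1) / real n + \<eta> \<le> x"
    using cell_bounds(1)[OF n k x] \<eta>(2)[of "k - 1"] k by (force simp: of_nat_diff)
  have upper: "x \<le> real k / real n - \<eta>"
    using cell_bounds(2)[OF n k x] \<eta>(2)[of k] k by auto
  \<comment> \<open>Lines \<open>j\<close> and \<open>k\<close> cross at \<open>m\<close>. Since
    \<open>j\<close> and \<open>k\<close> differ by at least 1, \<open>m\<close> lies at or beyond
    the left end of the cell if \<open>j < k\<close>, and at or beyond the right end if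
    \<open>j > k\<close>.\<close>
  define m where "m = ((real j + real k - 1) / 2) / real n"
  have key: "(real k - real j) * (x - m) \<ge> \<eta>"
  proof (cases "j < k")
    case True
    have "m \<le> (real k - 1) / real n"
      unfolding m_def using True by (intro divide_right_mono) auto
    with lower have "x - m \<ge> \<eta>"
      by linarith
    then show ?thesis
      using True \<eta>(1) mult_mono[of 1 "real k - real j" \<eta> "x - m"] by simp
  next
    case False
    have "m \<ge> real k / real n"
      unfolding m_def using False j by (intro divide_right_mono) auto
    with upper have "m - x \<ge> \<eta>"
      by linarith
    then have "(real j - real k) * (m - x) \<ge> \<eta>"
      using False j \<eta>(1) mult_mono[of 1 "real j - real k" \<eta> "m - x"] by simp
    then show ?thesis
      by (simp add: algebra_simps)
  qed
  have "fst (cell_params n l) k + snd (cell_params n l) k * x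
      - (fst (cell_params n l) j + snd (cell_params n l) j * x)
      = real l * ((real k - real j) * (x - m))"
    using k j n by (simp add: cell_params_def m_def field_simps)
  also have "\<dots> \<ge> real l * \<eta>"
    using key by (intro mult_left_mono) auto
  finally show ?thesis
    by simp
qed

lemma emeasure_UN_balls_le:
  fixes c :: "'i \<Rightarrow> real"
  assumes "finite I" "\<eta> \<ge> 0"
  shows "emeasure lebesgue (\<Union>i\<in>I. ball (c i) \<eta>) \<le> ennreal (2 * \<eta> * real (card I))"
proof -
  have "emeasure lebesgue (\<Union>i\<in>I. ball (c i) \<eta>) \<le> (\<Sum>i\<in>I. emeasure lebesgue (ball (c i) \<eta>))"
    using assms by (intro emeasure_subadditive_finite) auto
  also have "\<dots> = (\<Sum>i\<in>I. ennreal (2 * \<eta>))"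
    using assms by (intro sum.cong) (auto simp: ball_eq_greaterThanLessThan)
  also have "\<dots> = ennreal (2 * \<eta> * real (card I))"
    using assms by (simp add: ennreal_mult ennreal_of_nat_eq_real_of_nat mult.commute)
  finally show ?thesis .
qed

lemma uniform_limit_softmax_gate_cell:
  assumes n: "n \<ge> 1" and j: "j \<in> {1..n}" and "\<eta> > 0"
    and S: "S \<subseteq> {0..1}" "\<And>x i. x \<in> S \<Longrightarrow> i \<le> n \<Longrightarrow> \<bar>x - real i / real n\<bar> \<ge> \<eta>"
  shows "uniform_limit S (\<lambda>l. softmax_gate n (cell_params n l) j) (indicat_real (cell n j)) sequentially"
proof (rule uniform_limitI)
  fix e :: real
  assume "e > 0"
  have bound: "dist (softmax_gate n (cell_params n l) j x) (indicat_real (cell n j) x)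
      \<le> real n * exp (- (real l * \<eta>))" if "x \<in> S" for l x
  proof -
    have "x \<in> {0..1}"
      using that S(1) by blast
    \<comment> \<open>The winning index \<open>k\<close> varies with \<open>x\<close>, but the
      resulting bound does not, which makes the convergence uniform.\<close>
    then obtain k where k: "k \<in> {1..n}" "x \<in> cell n k"
      using ex_cell[OF n] by blast
    then have "x \<in> cell n j \<longleftrightarrow> j = k"
      using cell_unique[OF j] by blast
    then have "indicat_real (cell n j) x = of_bool (j = k)"
      by (simp add: indicator_def)
    moreover have "\<bar>softmax_gate n (cell_params n l) j x - of_bool (j = k)\<bar>
        \<le> real n * exp (- (real l * \<eta>))"
      using that \<open>\<eta> > 0\<close>
      by (intro softmax_gate_near_of_bool[OF k(1) j] cell_params_gap[OF k(1) _ _ k(2)] S(2)) simp_all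
    ultimately show ?thesis
      by (simp add: dist_real_def)
  qed
  have "(\<lambda>l. real n * exp (- (real l * \<eta>))) \<longlonglongrightarrow> 0"
    using \<open>\<eta> > 0\<close> by real_asymp
  then have "\<forall>\<^sub>F l in sequentially. real n * exp (- (real l * \<eta>)) < e"
    using \<open>e > 0\<close> by (rule order_tendstoD(2))
  then show "\<forall>\<^sub>F l in sequentially. \<forall>x\<in>S.
      dist (softmax_gate n (cell_params n l) j x) (indicat_real (cell n j) x) < e"
  proof eventually_elim
    case (elim l)
    then show ?case
      using bound[of _ l] by (meson le_less_trans)
  qed
qed

theorem lemma3:
  fixes n :: nat
  assumes "n \<ge> 1"
  shows "\<exists>(Gate :: nat \<Rightarrow> nat \<Rightarrow> real \<Rightarrow> real) (\<gamma> :: nat \<Rightarrow> (nat \<Rightarrow> real) \<times> (nat \<Rightarrow> real)).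
    (\<forall>l. \<gamma> l \<in> softmax_params n) \<and>
    (\<forall>l. Gate l = softmax_gate_vector n (\<gamma> l)) \<and>
    (\<forall>l. Gate l \<in> softmax_gating_class n) \<and>
    (\<forall>\<delta>>0. \<exists>E. E \<in> sets lebesgue \<and> E \<subseteq> {0..1} \<and> emeasure lebesgue E < ennreal \<delta> \<and>
       (\<forall>k\<in>{1..n}. uniform_limit ({0..1} - E) (\<lambda>l. Gate l k) (indicat_real (cell n k)) sequentially))"
proof (intro exI[of _ "\<lambda>l. softmax_gate_vector n (cell_params n l)"] exI[of _ "cell_params n"]
    conjI allI impI)
  show params: "cell_params n l \<in> softmax_params n" for l
    by (simp add: cell_params_def softmax_params_def)
  show "softmax_gate_vector n (cell_params n l) = softmax_gate_vector n (cell_params n l)" for l ..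
  show "softmax_gate_vector n (cell_params n l) \<in> softmax_gating_class n" for l
    using params by (simp add: softmax_gating_class_def)
  fix \<delta> :: real
  assume "\<delta> > 0"
  \<comment> \<open>There are \<open>n + 1\<close> grid points, 0 and 1 included, each with an
    interval of length \<open>2 * \<eta>\<close>. The \<open>n + 2\<close> makes the total strictly
    less than \<delta>.\<close>
  define \<eta> where "\<eta> = \<delta> / (2 * (real n + 2))"
  have "\<eta> > 0"
    using \<open>\<delta> > 0\<close> by (simp add: \<eta>_def)
  have less: "2 * \<eta> * (real n + 1) < \<delta>"
    using \<open>\<delta> > 0\<close> by (simp add: \<eta>_def field_simps)
  define U where "U = (\<Union>i\<in>{..n}. ball (real i / real n) \<eta>)"
  have "U \<in> sets lebesgue"
    by (auto simp: U_def)
  have "emeasure lebesgue ({0..1} \<inter> U) \<le> emeasure lebesgue U"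
    using \<open>U \<in> sets lebesgue\<close> by (intro emeasure_mono) auto
  also have "\<dots> \<le> ennreal (2 * \<eta> * (real n + 1))"
    using emeasure_UN_balls_le[of "{..n}" \<eta> "\<lambda>i. real i / real n"] \<open>\<eta> > 0\<close>
    by (simp add: U_def add.commute)
  also have "\<dots> < ennreal \<delta>"
    using less \<open>\<delta> > 0\<close> by (simp add: ennreal_lessI)
  finally have small: "emeasure lebesgue ({0..1} \<inter> U) < ennreal \<delta>" .
  have "uniform_limit ({0..1} - {0..1} \<inter> U) (\<lambda>l. softmax_gate_vector n (cell_params n l) k)
      (indicat_real (cell n k)) sequentially" if k: "k \<in> {1..n}" for k
  proof -
    have "uniform_limit ({0..1} - {0..1} \<inter> U) (\<lambda>l. softmax_gate n (cell_params n l) k)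
        (indicat_real (cell n k)) sequentially"
      using assms k \<open>\<eta> > 0\<close>
      by (rule uniform_limit_softmax_gate_cell)
        (auto simp: U_def dist_real_def abs_minus_commute not_less)
    \<comment> \<open>On this subset of \<open>{0..1}\<close> the restricted gate functions agree
      with \<open>softmax_gate\<close>, so the limit carries over.\<close>
    then show ?thesis
      by (rule uniform_limit_cong'[THEN iffD1, rotated 2])
        (use k in \<open>auto simp: softmax_gate_vector_def\<close>)
  qed
  with small \<open>U \<in> sets lebesgue\<close> show "\<exists>E. E \<in> sets lebesgue \<and> E \<subseteq> {0..1} \<and> emeasure lebesgue E < ennreal \<delta> \<and>
      (\<forall>k\<in>{1..n}. uniform_limit ({0..1} - E) (\<lambda>l. softmax_gate_vector n (cell_params n l) k)
        (indicat_real (cell n k)) sequentially)"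
    by (intro exI[of _ "{0..1} \<inter> U"]) auto
qed

end
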